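(* Let $C$ be a nonempty closed convex subset of a real Hilbert space $H$ and $T$ a Lipschitz pseudo-contraction from $C$ into itself with Lipschitz constant $L\ge1$ and $F(T)\ne\emptyset$. Assume $\{\tau_n\}_{n\ge0}\subset[\tau,1]$ with $\tau\in(0,1]$ and $\{\alpha_n\}_{n\ge0}\subset[a,b]$ with $a,b\in(0,\frac1{L+1})$. Let $x_0\in C$ be arbitrary and let $\{x_n\}$ be generated, for $n\ge0$, by $$y_n=(1-\alpha_n)x_n+\alpha_nTx_n,$$ $$C_n=\{z\in C:\tau_n\alpha_n[1-(1+L)\alpha_n]\|x_n-Tx_n\|^2\le\langle x_n-z,y_n-Ty_n\rangle\},$$ $$Q_n=\{z\in C:\langle z-x_n,x_n-x_0\rangle\ge0\},$$ $$x_{n+1}=P_{C_n^*\cap Q_n}x_0,$$ where $C_n^*$ is a closed convex set with $F(T)\subset C_n^*\subset C_n$. Then $\{x_n\}$ converges strongly to $P_{F(T)}x_0$.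
   Context: $F(T)=\{x\in C:Tx=x\}$. $T$ is a pseudo-contraction if $\|Tx-Ty\|^2\le\|x-y\|^2+\|(I-T)x-(I-T)y\|^2$ for all $x,y\in C$ ($I$ the identity). $T$ is Lipschitz with constant $L$ if $\|Tx-Ty\|\le L\|x-y\|$ for all $x,y\in C$. For a nonempty closed convex set $D\subset H$, $P_D$ is the metric projection (nearest-point map) onto $D$. *)

theory Defs
  imports "HOL-Analysis.Analysis"
begin

definition fixed_points :: "'a set \<Rightarrow> ('a \<Rightarrow> 'a) \<Rightarrow> 'a set" where
  "fixed_points C T = {x \<in> C. T x = x}"

definition pseudo_contraction_on :: "'a::real_inner set \<Rightarrow> ('a \<Rightarrow> 'a) \<Rightarrow> bool" where
  "pseudo_contraction_on C T \<longleftrightarrow>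
    (\<forall>x\<in>C. \<forall>y\<in>C.
      (norm (T x - T y))\<^sup>2 \<le> (norm (x - y))\<^sup>2 + (norm ((x - T x) - (y - T y)))\<^sup>2)"

(* The library's closest_point is restricted to the class heine_borel, which would
   force finite dimension. The value below is meaningful only when the nearest point exists
   and is unique, as for a nonempty closed convex set in a Hilbert space. *)
definition metric_proj :: "'a::metric_space set \<Rightarrow> 'a \<Rightarrow> 'a" where
  "metric_proj D u = (THE p. p \<in> D \<and> (\<forall>z\<in>D. dist u p \<le> dist u z))"

end

theory Submission
  imports Defs
begin

text \<open>
  Write \<open>A = I - T\<close>. The pseudo-contraction inequality says exactly that \<open>A\<close> is monotone, and the
  theorem follows from this monotonicity and the geometry of projections.

  The set \<open>Q n\<close> is the part of \<open>C\<close> beyond the hyperplane that touches the ball around \<open>x 0\<close> at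
  \<open>x n\<close> (all of \<open>C\<close> if \<open>x n = x 0\<close>). By induction it
  contains \<open>F(T)\<close>: this is the variational inequality of the projection that defines \<open>x n\<close>. Hence
  \<open>x (Suc n)\<close> is well defined, lies no further from \<open>x 0\<close> than \<open>q = P\<^sub>F x 0\<close> does, and satisfies
  \<open>\<parallel>x (n + 1) - x n\<parallel>\<^sup>2 \<le> \<parallel>x (n + 1) - x 0\<parallel>\<^sup>2 - \<parallel>x n - x 0\<parallel>\<^sup>2\<close>. The distances to \<open>x 0\<close> are therefore
  monotone and bounded, so consecutive iterates get close to each other. Membership of \<open>x (Suc n)\<close>
  in \<open>Cn n\<close> bounds a multiple of \<open>\<parallel>A (x n)\<parallel>\<^sup>2\<close> by \<open>\<parallel>x (n + 1) - x n\<parallel> \<parallel>A (y n)\<parallel>\<close>, and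
  \<open>\<parallel>A (y n)\<parallel> \<le> 2 \<parallel>A (x n)\<parallel>\<close> because \<open>A\<close> has Lipschitz constant \<open>1 + L\<close> and
  \<open>(1 + L) \<alpha> n < 1\<close>; so \<open>A (x n)\<close> tends to \<open>0\<close>.

  From \<open>\<parallel>x n - x 0\<parallel> \<le> \<parallel>q - x 0\<parallel>\<close> one gets \<open>\<parallel>x n - q\<parallel>\<^sup>2 \<le> 2 \<langle>x n - q, x 0 - q\<rangle>\<close>, so it is enough that
  the right-hand side is asymptotically nonpositive. The usual argument passes to a weakly
  convergent subsequence and uses demiclosedness of \<open>A\<close>. Both can be replaced by a single use of
  nested closed convex sets. By Minty's characterisation (lemma \<open>fixed_points_eq_Minty\<close>), a point
  \<open>p\<close> of \<open>C\<close> is fixed iff \<open>\<langle>A w, w - p\<rangle> \<ge> 0\<close> for all \<open>w \<in> C\<close>, a system of inequalities that are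
  affine in \<open>p\<close>. Approximate fixed points satisfy them up to a small error, and a
  decreasing sequence of nonempty bounded closed convex sets in a Hilbert space has a common point
  (lemma \<open>nested_closed_convex_Inter_nonempty\<close>). So if the iterates visited the half-space
  \<open>{p. \<langle>p - q, x 0 - q\<rangle> \<ge> \<delta>}\<close> with \<open>\<delta> > 0\<close> infinitely often, it would contain a fixed point
  (lemma \<open>fixed_point_in_closed_convex\<close>), against the variational inequality for \<open>q\<close>.
\<close>

section \<open>Nested convex sets and metric projections in Hilbert spaces\<close>

text \<open>
  Almost-minimal-norm elements \<open>p n\<close> of the sets form a Cauchy sequence: the midpoint of \<open>p m\<close> and
  \<open>p n\<close> lies in the larger of the two sets, so its norm is not much smaller than theirs, and the
  parallelogram law makes \<open>p m - p n\<close> small. This takes the place of weak compactness.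
\<close>

lemma nested_closed_convex_Inter_nonempty:
  fixes S :: "nat \<Rightarrow> 'a::{real_inner, complete_space} set"
  assumes closed: "\<And>n. closed (S n)" and convex: "\<And>n. convex (S n)"
    and nonempty: "\<And>n. S n \<noteq> {}" and dec: "decseq S" and bdd: "bounded (S 0)"
  shows "(\<Inter>n. S n) \<noteq> {}"
proof -
  obtain R where R: "\<And>z. z \<in> S 0 \<Longrightarrow> norm z \<le> R"
    using bdd by (auto simp: bounded_iff)
  define d where "d n = Inf (norm ` S n)" for n
  have bb: "bdd_below (norm ` S n)" for n
    by (rule bdd_belowI[of _ 0]) auto
  have d_le: "d n \<le> norm z" if "z \<in> S n" for n z
    unfolding d_def using that bb by (intro cInf_lower) auto
  have d_ge0: "0 \<le> d n" for n
    unfolding d_def using nonempty by (intro cInf_greatest) auto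
  have sub: "S m \<subseteq> S n" if "n \<le> m" for m n
    using dec that by (simp add: decseq_def)
  have d_mono: "d n \<le> d m" if "n \<le> m" for m n
    unfolding d_def using nonempty[of m] sub[OF that] bb[of n]
    by (intro cInf_superset_mono) auto
  have d_R: "d n \<le> R" for n
  proof -
    obtain z where "z \<in> S n" using nonempty by blast
    then show ?thesis using d_le[of z n] R[of z] sub[of 0 n] by force
  qed
  obtain l where l: "d \<longlonglongrightarrow> l" and d_l: "\<And>n. d n \<le> l"
    using incseq_convergent[of d R] d_mono d_R by (auto simp: incseq_def)
  define e where "e n = 1 / real (Suc n)" for n
  have e0: "e n > 0" for n by (simp add: e_def)
  have e_mono: "e m \<le> e n" if "n \<le> m" for m n
    using that by (simp add: e_def frac_le)
  have "\<exists>z\<in>S n. norm z < d n + e n" for n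
    using cInf_lessD[of "norm ` S n" "d n + e n"] nonempty e0[of n] by (auto simp: d_def)
  then obtain p where p: "\<And>n. p n \<in> S n" and p_less: "\<And>n. norm (p n) < d n + e n"
    by metis
  define g where "g n = 4 * ((l + e n)\<^sup>2 - (d n)\<^sup>2)" for n
  have "e \<longlonglongrightarrow> 0" unfolding e_def using LIMSEQ_inverse_real_of_nat by (simp add: inverse_eq_divide)
  then have "g \<longlonglongrightarrow> 4 * ((l + 0)\<^sup>2 - l\<^sup>2)"
    unfolding g_def using l by (intro tendsto_intros)
  then have g0: "g \<longlonglongrightarrow> 0" by simp
  have dist_le: "(norm (p n - p m))\<^sup>2 \<le> g n" if "n \<le> m" for n m
  proof -
    have "(1/2) *\<^sub>R p n + (1/2) *\<^sub>R p m \<in> S n"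
      using convex[of n] p[of n] p[of m] sub[OF that] by (intro convexD) auto
    then have "d n \<le> norm ((1/2) *\<^sub>R (p n + p m))"
      using d_le by (simp add: scaleR_add_right)
    then have "2 * d n \<le> norm (p n + p m)" by simp
    then have 1: "(2 * d n)\<^sup>2 \<le> (norm (p n + p m))\<^sup>2"
      using d_ge0[of n] by (intro power_mono) auto
    have 2: "(norm (p n))\<^sup>2 \<le> (l + e n)\<^sup>2"
      using p_less[of n] d_l[of n] by (intro power_mono) auto
    have 3: "(norm (p m))\<^sup>2 \<le> (l + e n)\<^sup>2"
      using p_less[of m] d_l[of m] e_mono[OF that] by (intro power_mono) auto
    have "(norm (p n - p m))\<^sup>2 = 2 * (norm (p n))\<^sup>2 + 2 * (norm (p m))\<^sup>2 - (norm (p n + p m))\<^sup>2"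
      by (simp add: power2_norm_eq_inner algebra_simps inner_commute)
    with 1 2 3 show ?thesis by (simp add: g_def power_mult_distrib)
  qed
  have "Cauchy p"
    unfolding Cauchy_altdef
  proof (intro allI impI)
    fix \<epsilon> :: real assume "\<epsilon> > 0"
    then have "\<forall>\<^sub>F n in sequentially. g n < \<epsilon>\<^sup>2"
      using order_tendstoD(2)[OF g0, of "\<epsilon>\<^sup>2"] by simp
    then obtain N where N: "\<And>n. n \<ge> N \<Longrightarrow> g n < \<epsilon>\<^sup>2"
      by (auto simp: eventually_sequentially)
    have "dist (p m) (p n) < \<epsilon>" if "m \<ge> N" "n > m" for m n
    proof -
      have "(norm (p m - p n))\<^sup>2 < \<epsilon>\<^sup>2" using dist_le[of m n] N[of m] that by simp
      then show ?thesis using \<open>\<epsilon> > 0\<close> by (simp add: dist_norm power_less_imp_less_base)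
    qed
    then show "\<exists>M. \<forall>m\<ge>M. \<forall>n>m. dist (p m) (p n) < \<epsilon>" by blast
  qed
  then obtain c where c: "p \<longlonglongrightarrow> c"
    using Cauchy_convergent convergent_def by blast
  have "c \<in> S n" for n
  proof (rule Lim_in_closed_set[OF closed _ _ c])
    show "\<forall>\<^sub>F k in sequentially. p k \<in> S n"
      using eventually_ge_at_top[of n] by eventually_elim (use p sub in blast)
  qed simp
  then show ?thesis by blast
qed

lemma obtuse_imp_norm_le:
  fixes u p z :: "'a::real_inner"
  assumes "(u - p) \<bullet> (z - p) \<le> 0"
  shows "(norm (u - p))\<^sup>2 + (norm (z - p))\<^sup>2 \<le> (norm (u - z))\<^sup>2"
proof -
  have "(norm (u - z))\<^sup>2 = (norm (u - p))\<^sup>2 + (norm (z - p))\<^sup>2 - 2 * ((u - p) \<bullet> (z - p))"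
    by (simp add: power2_norm_eq_inner algebra_simps inner_commute)
  with assms show ?thesis by simp
qed

text \<open>
  The intersection property applied to \<open>D \<inter> cball u (r + 1 / (n + 1))\<close>, with \<open>r\<close> the distance from
  \<open>u\<close> to \<open>D\<close>, gives a nearest point.
\<close>

lemma metric_proj_properties:
  fixes D :: "'a::{real_inner, complete_space} set"
  assumes "closed D" and "convex D" and "D \<noteq> {}"
  shows "metric_proj D u \<in> D"
    and "\<And>z. z \<in> D \<Longrightarrow> (u - metric_proj D u) \<bullet> (z - metric_proj D u) \<le> 0"
proof -
  define S where "S n = D \<inter> cball u (infdist u D + 1 / real (Suc n))" for n
  have "(\<Inter>n. S n) \<noteq> {}"
  proof (rule nested_closed_convex_Inter_nonempty)
    show "S n \<noteq> {}" for n
    proof -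
      have "infdist u D < infdist u D + 1 / real (Suc n)" by simp
      then obtain z where "z \<in> D" "dist u z < infdist u D + 1 / real (Suc n)"
        using \<open>D \<noteq> {}\<close> cInf_lessD[of "dist u ` D"] unfolding infdist_notempty[OF \<open>D \<noteq> {}\<close>]
        by blast
      then show ?thesis by (auto simp: S_def)
    qed
    show "decseq S"
      unfolding decseq_def S_def
    proof (intro allI impI Int_mono order_refl subset_cball add_left_mono)
      fix m n :: nat assume "m \<le> n"
      then show "1 / real (Suc n) \<le> 1 / real (Suc m)" by (simp add: frac_le)
    qed
  qed (use assms in \<open>auto simp: S_def intro: convex_Int\<close>)
  then obtain p where p: "\<And>n. p \<in> S n" by blast
  have pD: "p \<in> D" using p[of 0] by (simp add: S_def)
  have "(\<lambda>n. infdist u D + 1 / real (Suc n)) \<longlonglongrightarrow> infdist u D + 0"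
    using LIMSEQ_inverse_real_of_nat by (intro tendsto_intros) (simp add: inverse_eq_divide)
  then have "dist u p \<le> infdist u D + 0"
    by (rule LIMSEQ_le_const) (use p in \<open>auto simp: S_def\<close>)
  then have p_min: "dist u p \<le> dist u z" if "z \<in> D" for z
    using infdist_le[OF that, of u] by simp
  have eq: "metric_proj D u = p"
    unfolding metric_proj_def using pD p_min any_closest_point_unique[OF \<open>convex D\<close> \<open>closed D\<close>]
    by (intro the_equality) auto
  show "metric_proj D u \<in> D" by (simp add: eq pD)
  show "(u - metric_proj D u) \<bullet> (z - metric_proj D u) \<le> 0" if "z \<in> D" for z
    unfolding eq using assms(2,1) pD that p_min by (intro any_closest_point_dot) auto
qed

section \<open>Fixed points of Lipschitz pseudo-contractions\<close>

text \<open>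
  Expanding \<open>T x - T y = (x - y) - ((x - T x) - (y - T y))\<close> shows that a pseudo-contraction is the
  same thing as a map whose displacement \<open>I - T\<close> is monotone.
\<close>

lemma pseudo_contraction_displacement_monotone:
  assumes "pseudo_contraction_on C T" and "x \<in> C" and "y \<in> C"
  shows "((x - T x) - (y - T y)) \<bullet> (x - y) \<ge> 0"
proof -
  have "(norm (T x - T y))\<^sup>2 \<le> (norm (x - y))\<^sup>2 + (norm ((x - T x) - (y - T y)))\<^sup>2"
    using assms by (auto simp: pseudo_contraction_on_def)
  moreover have "(norm (T x - T y))\<^sup>2 = (norm (x - y))\<^sup>2 + (norm ((x - T x) - (y - T y)))\<^sup>2
      - 2 * (((x - T x) - (y - T y)) \<bullet> (x - y))"
    by (simp add: power2_norm_eq_inner algebra_simps inner_commute)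
  ultimately show ?thesis by simp
qed

lemma displacement_lipschitz:
  fixes T :: "'a::real_normed_vector \<Rightarrow> 'a"
  assumes "L-lipschitz_on C T" and "x \<in> C" and "y \<in> C"
  shows "norm ((x - T x) - (y - T y)) \<le> (1 + L) * norm (x - y)"
proof -
  have "norm ((x - T x) - (y - T y)) \<le> norm (x - y) + norm (T x - T y)"
    using norm_triangle_ineq4[of "x - y" "T x - T y"] by (simp add: algebra_simps)
  also have "norm (T x - T y) \<le> L * norm (x - y)"
    using lipschitz_onD[OF assms] by (simp add: dist_norm)
  finally show ?thesis by (simp add: algebra_simps)
qed

text \<open>
  Minty's trick: if \<open>p\<close> satisfies all the inequalities, apply the one at a point
  \<open>w = p + t (T p - p)\<close> with small \<open>t\<close>. It says that \<open>w - T w\<close> and \<open>p - T p\<close> make an obtuse angle,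
  although they are close to each other compared with their size; so \<open>p - T p = 0\<close>.
\<close>

lemma fixed_points_eq_Minty:
  fixes C :: "'a::real_inner set"
  assumes "convex C" and maps: "T \<in> C \<rightarrow> C" and pc: "pseudo_contraction_on C T"
    and lip: "L-lipschitz_on C T"
  shows "fixed_points C T = C \<inter> (\<Inter>w\<in>C. {p. (w - T w) \<bullet> (w - p) \<ge> 0})"
proof (intro equalityI subsetI)
  fix p assume "p \<in> fixed_points C T"
  then have p: "p \<in> C" "T p = p" by (auto simp: fixed_points_def)
  have "(w - T w) \<bullet> (w - p) \<ge> 0" if "w \<in> C" for w
    using pseudo_contraction_displacement_monotone[OF pc that p(1)] p(2) by simp
  then show "p \<in> C \<inter> (\<Inter>w\<in>C. {p. (w - T w) \<bullet> (w - p) \<ge> 0})" using p by blast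
next
  fix p assume "p \<in> C \<inter> (\<Inter>w\<in>C. {p. (w - T w) \<bullet> (w - p) \<ge> 0})"
  then have p: "p \<in> C" and ineq: "\<And>w. w \<in> C \<Longrightarrow> (w - T w) \<bullet> (w - p) \<ge> 0" by auto
  have L: "L \<ge> 0" using lip by (rule lipschitz_on_nonneg)
  define v where "v = p - T p"
  \<comment> \<open>\<open>I - T\<close> has Lipschitz constant \<open>1 + L\<close>, so a step of this length changes the displacement
    by at most half of its norm.\<close>
  define t where "t = 1 / (2 * (1 + L))"
  have t: "0 < t" "t \<le> 1" "(1 + L) * t = 1 / 2"
    using L by (auto simp: t_def field_simps)
  define w where "w = (1 - t) *\<^sub>R p + t *\<^sub>R T p"
  have w: "w \<in> C"
    unfolding w_def using assms p t by (intro convexD_alt) auto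
  have wp: "w - p = - (t *\<^sub>R v)" by (simp add: w_def v_def algebra_simps)
  have "t * ((w - T w) \<bullet> v) \<le> 0" using ineq[OF w] by (simp add: wp)
  then have "(w - T w) \<bullet> v \<le> 0" using t by (simp add: mult_le_0_iff)
  then have "v \<bullet> v \<le> (v - (w - T w)) \<bullet> v" by (simp add: inner_diff_left)
  also have "\<dots> \<le> norm (v - (w - T w)) * norm v" by (rule norm_cauchy_schwarz)
  also have "\<dots> \<le> ((1 + L) * norm (p - w)) * norm v"
    unfolding v_def using displacement_lipschitz[OF lip p w] by (rule mult_right_mono) simp
  also have "norm (p - w) = t * norm v"
    using t by (simp add: norm_minus_commute[of p w] wp)
  also have "((1 + L) * (t * norm v)) * norm v = ((1 + L) * t) * (v \<bullet> v)"
    by (simp add: power2_norm_eq_inner[symmetric] power2_eq_square)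
  also have "\<dots> = 1 / 2 * (v \<bullet> v)" by (simp only: t(3))
  finally have "v \<bullet> v \<le> 0" by simp
  then have "v = 0" by (simp add: power2_norm_eq_inner[symmetric])
  then show "p \<in> fixed_points C T" using p by (simp add: fixed_points_def v_def)
qed

lemma closed_convex_displacement_halfspace:
  fixes v w :: "'a::real_inner"
  shows "closed {p. v \<bullet> (w - p) \<ge> c}" and "convex {p. v \<bullet> (w - p) \<ge> c}"
proof -
  have "{p. v \<bullet> (w - p) \<ge> c} = {p. v \<bullet> p \<le> v \<bullet> w - c}"
    by (auto simp: inner_diff_right)
  then show "closed {p. v \<bullet> (w - p) \<ge> c}" and "convex {p. v \<bullet> (w - p) \<ge> c}"
    by (simp_all add: closed_halfspace_le convex_halfspace_le)
qed

lemma closed_convex_fixed_points: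
  fixes C :: "'a::real_inner set"
  assumes "closed C" and "convex C" and "T \<in> C \<rightarrow> C" and "pseudo_contraction_on C T"
    and "L-lipschitz_on C T"
  shows "closed (fixed_points C T)" and "convex (fixed_points C T)"
  unfolding fixed_points_eq_Minty[OF assms(2-5)] using assms(1,2)
  by (auto intro!: closed_Int closed_INT convex_Int convex_INT closed_convex_displacement_halfspace)

text \<open>
  This is what demiclosedness of \<open>I - T\<close> at \<open>0\<close> is used for. Points with small displacement satisfy
  the inequalities of \<open>fixed_points_eq_Minty\<close> with a small error; as these inequalities are affine,
  the points of \<open>K\<close> that satisfy them up to a given error form closed convex sets, which decrease
  as the error does.
\<close>

lemma fixed_point_in_closed_convex:
  fixes C :: "'a::{real_inner, complete_space} set"
  assumes "closed C" and "convex C" and "T \<in> C \<rightarrow> C" and pc: "pseudo_contraction_on C T"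
    and "L-lipschitz_on C T"
    and "closed K" and "convex K"
    and xC: "\<And>n. x n \<in> C" and bdd: "bounded (range x)"
    and lim: "(\<lambda>n. x n - T (x n)) \<longlonglongrightarrow> 0"
    and freq: "\<exists>\<^sub>F n in sequentially. x n \<in> K"
  shows "fixed_points C T \<inter> K \<noteq> {}"
proof -
  obtain R where R: "\<And>n. norm (x n) \<le> R"
    using bdd by (auto simp: bounded_iff)
  define e where "e k = 1 / real (Suc k)" for k
  have e0: "e k > 0" for k by (simp add: e_def)
  have R0: "R \<ge> 0" using R[of 0] norm_ge_zero order_trans by blast
  define S where "S k = K \<inter> C \<inter> cball 0 R \<inter>
    (\<Inter>w\<in>C. {p. (w - T w) \<bullet> (w - p) \<ge> - (e k * (norm w + R))})" for k
  have "(\<Inter>k. S k) \<noteq> {}"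
  proof (rule nested_closed_convex_Inter_nonempty)
    show "closed (S k)" for k
      unfolding S_def using assms
      by (intro closed_Int closed_INT ballI closed_cball closed_convex_displacement_halfspace) auto
    show "convex (S k)" for k
      unfolding S_def using assms
      by (intro convex_Int convex_INT convex_cball closed_convex_displacement_halfspace) auto
    show "S k \<noteq> {}" for k
    proof -
      have "\<forall>\<^sub>F n in sequentially. norm (x n - T (x n)) < e k"
        using order_tendstoD(2)[OF tendsto_norm[OF lim], of "e k"] e0 by simp
      with freq have "\<exists>\<^sub>F n in sequentially. x n \<in> K \<and> norm (x n - T (x n)) < e k"
        by (rule frequently_eventually_frequently)
      then obtain n where n: "x n \<in> K" "norm (x n - T (x n)) < e k"
        using frequently_ex by blast
      have "- (e k * (norm w + R)) \<le> (w - T w) \<bullet> (w - x n)" if w: "w \<in> C" for w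
      proof -
        have "\<bar>(x n - T (x n)) \<bullet> (w - x n)\<bar> \<le> norm (x n - T (x n)) * norm (w - x n)"
          by (rule Cauchy_Schwarz_ineq2)
        also have "norm (w - x n) \<le> norm w + R"
          using norm_triangle_ineq4[of w "x n"] R[of n] by simp
        then have "norm (x n - T (x n)) * norm (w - x n) \<le> e k * (norm w + R)"
          using n by (intro mult_mono) (auto simp: e_def)
        finally show ?thesis
          using pseudo_contraction_displacement_monotone[OF pc w xC[of n]]
          by (simp add: inner_diff_left)
      qed
      then have "x n \<in> S k" using n xC R by (auto simp: S_def)
      then show ?thesis by blast
    qed
    show "decseq S"
      unfolding decseq_def
    proof (intro allI impI subsetI)
      fix m n :: nat and p assume mn: "m \<le> n" and p: "p \<in> S n"
      have "- (e m * (norm w + R)) \<le> - (e n * (norm w + R))" for w :: 'a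
        using mn R0 by (auto simp: e_def frac_le intro!: mult_right_mono)
      then have "- (e m * (norm w + R)) \<le> (w - T w) \<bullet> (w - p)" if "w \<in> C" for w
        by (rule order_trans) (use p that in \<open>simp add: S_def\<close>)
      then show "p \<in> S m" using p by (simp add: S_def)
    qed
    show "bounded (S 0)" by (rule bounded_subset[of "cball 0 R"]) (auto simp: S_def)
  qed
  then obtain p where p: "\<And>k. p \<in> S k" by blast
  have "(w - T w) \<bullet> (w - p) \<ge> 0" if "w \<in> C" for w
  proof -
    have "e \<longlonglongrightarrow> 0" unfolding e_def using LIMSEQ_inverse_real_of_nat by (simp add: inverse_eq_divide)
    then have "(\<lambda>k. - (e k * (norm w + R))) \<longlonglongrightarrow> - (0 * (norm w + R))"
      by (intro tendsto_intros)
    then have "(w - T w) \<bullet> (w - p) \<ge> - (0 * (norm w + R))"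
      by (rule LIMSEQ_le_const2) (use p that in \<open>auto simp: S_def\<close>)
    then show ?thesis by simp
  qed
  then have "p \<in> fixed_points C T"
    unfolding fixed_points_eq_Minty[OF assms(2-5)] using p[of 0] by (auto simp: S_def)
  moreover have "p \<in> K" using p[of 0] by (simp add: S_def)
  ultimately show ?thesis by blast
qed

section \<open>The hybrid projection method\<close>

theorem theorem5p1:
  fixes C :: "'a::{real_inner, complete_space} set"
    and T :: "'a \<Rightarrow> 'a"
    and L \<tau>\<^sub>0 a b :: real
    and \<tau> \<alpha> :: "nat \<Rightarrow> real"
    and x y :: "nat \<Rightarrow> 'a"
    and Cn Cstar Q :: "nat \<Rightarrow> 'a set"
  assumes "C \<noteq> {}" and "closed C" and "convex C"
    and "T \<in> C \<rightarrow> C"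
    and "pseudo_contraction_on C T"
    and "L-lipschitz_on C T" and "L \<ge> 1"
    and "fixed_points C T \<noteq> {}"
    and "\<tau>\<^sub>0 \<in> {0<..1}" and "\<And>n. \<tau> n \<in> {\<tau>\<^sub>0..1}"
    and "a \<in> {0<..<1 / (L + 1)}" and "b \<in> {0<..<1 / (L + 1)}"
    and "\<And>n. \<alpha> n \<in> {a..b}"
    and "x 0 \<in> C"
    and "\<And>n. y n = (1 - \<alpha> n) *\<^sub>R x n + \<alpha> n *\<^sub>R T (x n)"
    and "\<And>n. Cn n = {z \<in> C. \<tau> n * \<alpha> n * (1 - (1 + L) * \<alpha> n) * (norm (x n - T (x n)))\<^sup>2
                              \<le> (x n - z) \<bullet> (y n - T (y n))}"
    and "\<And>n. Q n = {z \<in> C. (z - x n) \<bullet> (x n - x 0) \<ge> 0}"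
    and "\<And>n. closed (Cstar n)" and "\<And>n. convex (Cstar n)"
    and "\<And>n. fixed_points C T \<subseteq> Cstar n" and "\<And>n. Cstar n \<subseteq> Cn n"
    and "\<And>n. x (Suc n) = metric_proj (Cstar n \<inter> Q n) (x 0)"
  shows "x \<longlonglongrightarrow> metric_proj (fixed_points C T) (x 0)"
proof -
  let ?F = "fixed_points C T"
  note clC = \<open>closed C\<close> and cvC = \<open>convex C\<close> and maps = \<open>T \<in> C \<rightarrow> C\<close>
    and pc = \<open>pseudo_contraction_on C T\<close> and lip = \<open>L-lipschitz_on C T\<close> and L1 = \<open>L \<ge> 1\<close>
  note tau0 = assms(9) and tau = assms(10) and a = assms(11) and b = assms(12) and alpha = assms(13)
    and x0 = assms(14) and y = assms(15) and Cn = assms(16) and Q = assms(17)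
    and clCs = assms(18) and cvCs = assms(19) and F_Cs = assms(20) and Cs_Cn = assms(21)
    and step = assms(22)
  define D where "D n = Cstar n \<inter> Q n" for n
  have Q_eq: "Q n = C \<inter> {z. (x 0 - x n) \<bullet> (x n - z) \<ge> 0}" for n
    unfolding Q by (auto simp: algebra_simps inner_commute)
  have clD: "closed (D n)" and cvD: "convex (D n)" for n
    unfolding D_def Q_eq using clC cvC clCs cvCs
    by (auto intro!: closed_Int convex_Int closed_convex_displacement_halfspace)
  have F_C: "?F \<subseteq> C" by (auto simp: fixed_points_def)
  have F_D: "?F \<subseteq> D n" for n
  proof (induction n)
    case 0
    show ?case using F_C F_Cs by (auto simp: D_def Q)
  next
    case (Suc n)
    then have "D n \<noteq> {}" using \<open>?F \<noteq> {}\<close> by blast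
    from metric_proj_properties(2)[OF clD cvD this, of _ "x 0"]
    have "(x 0 - x (Suc n)) \<bullet> (z - x (Suc n)) \<le> 0" if "z \<in> ?F" for z
      using Suc that unfolding D_def step by blast
    then show ?case using F_C F_Cs unfolding D_def Q
      by (fastforce simp: algebra_simps inner_commute)
  qed
  then have D_ne: "D n \<noteq> {}" for n using \<open>?F \<noteq> {}\<close> by blast
  have xD: "x (Suc n) \<in> D n"
    and x_obtuse: "\<And>z. z \<in> D n \<Longrightarrow> (x 0 - x (Suc n)) \<bullet> (z - x (Suc n)) \<le> 0" for n
    using metric_proj_properties[OF clD[of n] cvD D_ne, where u = "x 0"]
    by (simp_all add: step D_def)
  have xC: "x n \<in> C" for n
    using x0 xD by (cases n) (auto simp: D_def Q)

  define q where "q = metric_proj ?F (x 0)"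
  have qF: "q \<in> ?F" and q_obtuse: "\<And>z. z \<in> ?F \<Longrightarrow> (x 0 - q) \<bullet> (z - q) \<le> 0"
    using metric_proj_properties[OF closed_convex_fixed_points[OF clC cvC maps pc lip] \<open>?F \<noteq> {}\<close>,
        where u = "x 0"]
    by (simp_all add: q_def)
  have x_le_q: "(norm (x 0 - x n))\<^sup>2 \<le> (norm (x 0 - q))\<^sup>2" for n
  proof (cases n)
    case (Suc m)
    have "(norm (x 0 - x n))\<^sup>2 + (norm (q - x n))\<^sup>2 \<le> (norm (x 0 - q))\<^sup>2"
      unfolding Suc using x_obtuse[of q m] F_D qF by (intro obtuse_imp_norm_le) auto
    then show ?thesis using zero_le_power2[of "norm (q - x n)"] by linarith
  qed simp

  \<comment> \<open>The increments of the monotone bounded sequence of squared distances to the starting point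
    dominate the squared lengths of the steps.\<close>
  have x_step: "(norm (x 0 - x n))\<^sup>2 + (norm (x (Suc n) - x n))\<^sup>2 \<le> (norm (x 0 - x (Suc n)))\<^sup>2" for n
  proof (rule obtuse_imp_norm_le)
    show "(x 0 - x n) \<bullet> (x (Suc n) - x n) \<le> 0"
      using xD[of n] by (simp add: D_def Q algebra_simps inner_commute)
  qed
  have step0: "(\<lambda>n. norm (x (Suc n) - x n)) \<longlonglongrightarrow> 0"
  proof -
    define h where "h n = (norm (x 0 - x n))\<^sup>2" for n
    have "incseq h"
    proof (rule incseq_SucI)
      fix n
      show "h n \<le> h (Suc n)"
        using x_step[of n] zero_le_power2[of "norm (x (Suc n) - x n)"] unfolding h_def by linarith
    qed
    moreover have "\<forall>n. h n \<le> (norm (x 0 - q))\<^sup>2" using x_le_q by (simp add: h_def)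
    ultimately obtain l where l: "h \<longlonglongrightarrow> l" using incseq_convergent by blast
    have "(\<lambda>n. h (Suc n) - h n) \<longlonglongrightarrow> l - l"
      using l LIMSEQ_Suc[OF l] by (intro tendsto_diff)
    then have hz: "(\<lambda>n. h (Suc n) - h n) \<longlonglongrightarrow> 0" by simp
    have "(\<lambda>n. (norm (x (Suc n) - x n))\<^sup>2) \<longlonglongrightarrow> 0"
    proof (rule tendsto_sandwich[OF _ _ tendsto_const hz])
      show "\<forall>\<^sub>F n in sequentially. (norm (x (Suc n) - x n))\<^sup>2 \<le> h (Suc n) - h n"
        using x_step by (simp add: h_def algebra_simps)
    qed simp
    then show ?thesis by simp
  qed

  \<comment> \<open>Uniform lower bound for the coefficients in the sets \<open>Cn n\<close>; it is positive because
    \<open>b < 1 / (L + 1)\<close>.\<close>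
  define c where "c = \<tau>\<^sub>0 * a * (1 - (1 + L) * b)"
  have bL: "(1 + L) * b < 1" using b L1 by (simp add: field_simps)
  have c0: "c > 0" using tau0 a bL by (simp add: c_def)
  have disp: "c * norm (x n - T (x n)) \<le> 2 * norm (x (Suc n) - x n)" for n
  proof -
    let ?A = "norm (x n - T (x n))"
    have al: "0 < \<alpha> n" "a \<le> \<alpha> n" "(1 + L) * \<alpha> n \<le> (1 + L) * b"
      using alpha[of n] a L1 by auto
    then have al1: "(1 + L) * \<alpha> n < 1" using bL by linarith
    have "\<alpha> n \<le> (1 + L) * \<alpha> n" using al L1 by simp
    then have "\<alpha> n \<le> 1" using al1 by linarith
    then have yC: "y n \<in> C"
      unfolding y using cvC xC[of n] maps al by (intro convexD_alt) auto
    have yx: "y n - x n = - (\<alpha> n *\<^sub>R (x n - T (x n)))" by (simp add: y algebra_simps)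
    have "norm (y n - T (y n)) \<le> norm (x n - T (x n)) + norm ((y n - T (y n)) - (x n - T (x n)))"
      using norm_triangle_ineq[of "x n - T (x n)" "(y n - T (y n)) - (x n - T (x n))"] by simp
    also have "\<dots> \<le> ?A + (1 + L) * norm (y n - x n)"
      using displacement_lipschitz[OF lip yC xC[of n]] by simp
    also have "\<dots> = ?A + ((1 + L) * \<alpha> n) * ?A" using al by (simp add: yx)
    also have "\<dots> \<le> ?A + 1 * ?A"
      using al1 by (intro add_left_mono mult_right_mono) auto
    finally have Ay: "norm (y n - T (y n)) \<le> 2 * ?A" by simp
    have "c \<le> \<tau> n * \<alpha> n * (1 - (1 + L) * \<alpha> n)"
      unfolding c_def using al al1 bL tau[of n] tau0 a by (intro mult_mono) auto
    then have "c * ?A\<^sup>2 \<le> \<tau> n * \<alpha> n * (1 - (1 + L) * \<alpha> n) * ?A\<^sup>2" by (rule mult_right_mono) simp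
    also have "\<dots> \<le> (x n - x (Suc n)) \<bullet> (y n - T (y n))"
      using xD[of n] Cs_Cn[of n] unfolding D_def Cn by auto
    also have "\<dots> \<le> norm (x n - x (Suc n)) * norm (y n - T (y n))" by (rule norm_cauchy_schwarz)
    also have "\<dots> \<le> norm (x n - x (Suc n)) * (2 * ?A)" using Ay by (intro mult_left_mono) auto
    finally have "(c * ?A) * ?A \<le> (2 * norm (x (Suc n) - x n)) * ?A"
      by (simp add: power2_eq_square norm_minus_commute algebra_simps)
    then show ?thesis
      using mult_right_le_imp_le[of "c * ?A" ?A] by (cases "?A = 0") simp_all
  qed
  have disp0: "(\<lambda>n. x n - T (x n)) \<longlonglongrightarrow> 0"
  proof (rule Lim_null_comparison)
    show "\<forall>\<^sub>F n in sequentially. norm (x n - T (x n)) \<le> (2 / c) * norm (x (Suc n) - x n)"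
      using disp c0 by (simp add: field_simps)
    show "(\<lambda>n. (2 / c) * norm (x (Suc n) - x n)) \<longlonglongrightarrow> 0"
      using step0 by (rule tendsto_mult_right_zero)
  qed

  have bdd: "bounded (range x)"
  proof -
    have "dist (x 0) (x n) \<le> norm (x 0 - q)" for n
      using power2_le_imp_le[OF x_le_q[of n]] by (simp add: dist_norm)
    then show ?thesis unfolding bounded_def by blast
  qed
  have angle: "(norm (x n - q))\<^sup>2 \<le> 2 * ((x 0 - q) \<bullet> (x n - q))" for n
  proof -
    have "(norm (x 0 - x n))\<^sup>2 = (norm (x 0 - q))\<^sup>2 + (norm (x n - q))\<^sup>2 - 2 * ((x 0 - q) \<bullet> (x n - q))"
      by (simp add: power2_norm_eq_inner algebra_simps inner_commute)
    then show ?thesis using x_le_q[of n] by linarith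
  qed
  \<comment> \<open>Otherwise the iterates would keep visiting a half-space \<open>K\<close> that the variational inequality
    for \<open>q\<close> separates from the fixed points.\<close>
  have ev: "\<forall>\<^sub>F n in sequentially. (x 0 - q) \<bullet> (x n - q) < \<delta>" if "\<delta> > 0" for \<delta>
  proof (rule ccontr)
    define K where "K = {z. (q - x 0) \<bullet> (q - z) \<ge> \<delta>}"
    have K: "z \<in> K \<longleftrightarrow> \<delta> \<le> (x 0 - q) \<bullet> (z - q)" for z
      unfolding K_def by (simp add: algebra_simps)
    assume "\<not> ?thesis"
    then have "\<exists>\<^sub>F n in sequentially. x n \<in> K"
      by (simp add: K not_eventually not_less)
    then have "?F \<inter> K \<noteq> {}"
      using clC cvC maps pc lip xC bdd disp0
      by (intro fixed_point_in_closed_convex)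
        (auto simp: K_def intro: closed_convex_displacement_halfspace)
    then show False using q_obtuse K \<open>\<delta> > 0\<close> by force
  qed
  have "x \<longlonglongrightarrow> q"
  proof (rule tendstoI)
    fix \<epsilon> :: real assume "\<epsilon> > 0"
    then have "\<forall>\<^sub>F n in sequentially. (x 0 - q) \<bullet> (x n - q) < \<epsilon>\<^sup>2 / 2" by (intro ev) simp
    then show "\<forall>\<^sub>F n in sequentially. dist (x n) q < \<epsilon>"
    proof eventually_elim
      case (elim n)
      then have "(norm (x n - q))\<^sup>2 < \<epsilon>\<^sup>2" using angle[of n] by simp
      then show ?case using \<open>\<epsilon> > 0\<close> by (simp add: dist_norm power_less_imp_less_base)
    qed
  qed
  then show ?thesis by (simp add: q_def)
qed

end
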